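(* All R2 utilities are monotone and submodular. That is, let $\{s_{\boldsymbol{\theta}}: \mathbb{R}^M \to \mathbb{R} : \boldsymbol{\theta} \in \Theta\}$ be a family of scalarisation functions, let $p(\boldsymbol{\theta}) \geq 0$ be a probability density on $\Theta$, and let $U:\mathbb{B}(\mathbb{R}^M)\to\mathbb{R}$, $U(Y) = \mathbb{E}_{p(\boldsymbol{\theta})}[\max_{\mathbf{y} \in Y} s_{\boldsymbol{\theta}}(\mathbf{y})]$, be the corresponding R2 utility. Then for all sets $A, B \in \mathbb{B}(\mathbb{R}^M)$ with $A \subseteq B$ and every $\mathbf{c} \in \mathbb{R}^M$, $$U(A) \leq U(B) \quad\text{and}\quad U(A \cup \{\mathbf{c}\}) - U(A) \geq U(B \cup \{\mathbf{c}\}) - U(B).$$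
   Context: $\mathbb{B}(\mathbb{R}^M) = \{Y \subseteq \mathbb{R}^M : |Y| < \infty\}$ denotes the collection of finite subsets of $\mathbb{R}^M$. A scalarisation function is a function $s: \mathbb{R}^M \to \mathbb{R}$. Given a family $\{s_{\boldsymbol{\theta}}\}_{\boldsymbol{\theta}\in\Theta}$ of scalarisation functions and a probability density $p(\boldsymbol{\theta}) \ge 0$ on $\Theta$, the associated R2 utility is the set function $U(Y) = \mathbb{E}_{p(\boldsymbol{\theta})}[S_{\boldsymbol{\theta}}(Y)]$ for $Y \in \mathbb{B}(\mathbb{R}^M)$, where $S_{\boldsymbol{\theta}}:\mathbb{B}(\mathbb{R}^M)\to\mathbb{R}$ is the set function $S_{\boldsymbol{\theta}}(Y) = \max_{\mathbf{y}\in Y} s_{\boldsymbol{\theta}}(\mathbf{y})$. R2 utilities are assumed throughout to be well-defined in the sense that the integrals over the scalarisation parameter $\boldsymbol{\theta}$ exist and are finite. A set function $U:\mathbb{B}(\Omega)\to\mathbb{R}$ on the finite subsets of a ground set $\Omega$ is called monotone if $U(A)\le U(B)$ for all $A,B\in\mathbb{B}(\Omega)$ with $A\subseteq B$, and submodular if it satisfies the diminishing returns property: $U(A \cup \{\mathbf{c}\}) - U(A) \geq U(B \cup \{\mathbf{c}\}) - U(B)$ for all $A,B\in\mathbb{B}(\Omega)$ with $A \subseteq B$ and all $\mathbf{c}\in\Omega$. Here the ground set is $\Omega=\mathbb{R}^M$ (it is not required to be finite).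
   Formalization: The maximum over the empty set is undefined, and no real value works in general (s(y)=y); the result is proved for nonempty finite A, B, and for all finite sets when the value assigned to the empty set is, for each θ, at most every s_θ(y). *)

theory Defs
  imports "HOL-Probability.Probability"
begin

text \<open>
  A maximum over the empty set is not determined by the formula for the set scalarisation, so its
  real value there is a parameter \<open>e \<theta>\<close>, arbitrary unless a hypothesis says otherwise.
\<close>

definition set_scalarisation ::
  "('t \<Rightarrow> real) \<Rightarrow> ('t \<Rightarrow> 'a \<Rightarrow> real) \<Rightarrow> 't \<Rightarrow> 'a set \<Rightarrow> real" where
  "set_scalarisation e s \<theta> Y = (if Y = {} then e \<theta> else Max (s \<theta> ` Y))"

text \<open>
  The parameter space is \<open>space T\<close>, where \<open>T\<close> is the reference measure
  (Lebesgue measure, counting measure, ...) with respect to which \<open>p\<close> is a density.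
\<close>

definition probability_density :: "'t measure \<Rightarrow> ('t \<Rightarrow> real) \<Rightarrow> bool" where
  "probability_density T p \<longleftrightarrow>
     p \<in> borel_measurable T \<and> (\<forall>\<theta>\<in>space T. 0 \<le> p \<theta>) \<and> prob_space (density T p)"

definition R2_utility ::
  "'t measure \<Rightarrow> ('t \<Rightarrow> real) \<Rightarrow> ('t \<Rightarrow> real) \<Rightarrow> ('t \<Rightarrow> 'a \<Rightarrow> real) \<Rightarrow> 'a set \<Rightarrow> real" where
  "R2_utility T p e s Y = (\<integral>\<theta>. set_scalarisation e s \<theta> Y \<partial>density T p)"

definition R2_well_defined ::
  "'t measure \<Rightarrow> ('t \<Rightarrow> real) \<Rightarrow> ('t \<Rightarrow> real) \<Rightarrow> ('t \<Rightarrow> 'a \<Rightarrow> real) \<Rightarrow> bool" where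
  "R2_well_defined T p e s \<longleftrightarrow>
     (\<forall>Y. finite Y \<longrightarrow> integrable (density T p) (\<lambda>\<theta>. set_scalarisation e s \<theta> Y))"

text \<open>
  Diminishing returns for sets in a family \<open>\<B>\<close>, with increments ranging over the whole type;
  meant for families closed under inserting a point. Monotonicity is the library's
  \<^const>\<open>monotone_on\<close> for inclusion, i.e. \<open>mono_on \<B> U\<close>.
\<close>

definition submodular_on :: "'a set set \<Rightarrow> ('a set \<Rightarrow> real) \<Rightarrow> bool" where
  "submodular_on \<B> U \<longleftrightarrow>
     (\<forall>A\<in>\<B>. \<forall>B\<in>\<B>. \<forall>c. A \<subseteq> B \<longrightarrow> U (A \<union> {c}) - U A \<ge> U (B \<union> {c}) - U B)"

end

theory Submission
  imports Defs
begin

text \<open>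
  For a fixed parameter \<open>\<theta>\<close>, adjoining a point \<open>c\<close> to \<open>Y\<close> replaces the maximum \<open>m\<close> of the scores
  over \<open>Y\<close> by \<open>max (s \<theta> c) m\<close>, so the marginal gain is the positive part of \<open>s \<theta> c - m\<close>. The maximum
  grows with \<open>Y\<close> and the positive part shrinks as \<open>m\<close> grows, hence the set scalarisation is monotone
  and submodular (\<open>mono_on_set_scalarisation\<close>, \<open>submodular_on_set_scalarisation\<close>). Both properties
  are linear inequalities between finitely many values of the set function, so they survive taking
  an expectation over \<open>\<theta>\<close> (\<open>mono_on_R2_utility\<close>, \<open>submodular_on_R2_utility\<close>).

  The empty set fits into this argument exactly when its value \<open>e \<theta>\<close> behaves like a maximum over no
  points, that is, lies below every score. The pointwise lemmas therefore speak of the family of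
  finite sets that are nonempty unless \<open>e \<theta>\<close> is such a lower bound, which covers both the
  unconditional claim for nonempty sets and the conditional claim for all finite sets.
\<close>

lemma set_scalarisation_insert:
  assumes "finite Y" and "Y \<noteq> {} \<or> e \<theta> \<le> s \<theta> c"
  shows "set_scalarisation e s \<theta> (insert c Y) = max (s \<theta> c) (set_scalarisation e s \<theta> Y)"
  using assms by (auto simp: set_scalarisation_def)

lemma mono_on_set_scalarisation:
  fixes s :: "'t \<Rightarrow> 'a \<Rightarrow> real"
  shows "mono_on {Y. finite Y \<and> (Y = {} \<longrightarrow> (\<forall>y. e \<theta> \<le> s \<theta> y))} (set_scalarisation e s \<theta>)"
proof (intro mono_onI)
  fix A B :: "'a set"
  assume A: "A \<in> {Y. finite Y \<and> (Y = {} \<longrightarrow> (\<forall>y. e \<theta> \<le> s \<theta> y))}"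
    and B: "B \<in> {Y. finite Y \<and> (Y = {} \<longrightarrow> (\<forall>y. e \<theta> \<le> s \<theta> y))}"
    and "A \<subseteq> B"
  show "set_scalarisation e s \<theta> A \<le> set_scalarisation e s \<theta> B"
  proof (cases "A = {}")
    case True
    then show ?thesis
      using A B by (auto simp: set_scalarisation_def Max_ge_iff)
  next
    case False
    with \<open>A \<subseteq> B\<close> B show ?thesis
      by (auto simp: set_scalarisation_def intro!: Max_mono)
  qed
qed

text \<open>
  The gain \<open>max (s \<theta> c) m - m\<close> is antitone in the current maximum \<open>m\<close>, so diminishing returns follow
  from monotonicity.
\<close>

lemma submodular_on_set_scalarisation:
  fixes s :: "'t \<Rightarrow> 'a \<Rightarrow> real"
  shows "submodular_on {Y. finite Y \<and> (Y = {} \<longrightarrow> (\<forall>y. e \<theta> \<le> s \<theta> y))} (set_scalarisation e s \<theta>)"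
  unfolding submodular_on_def
proof (intro ballI allI impI)
  fix A B :: "'a set" and c
  assume A: "A \<in> {Y. finite Y \<and> (Y = {} \<longrightarrow> (\<forall>y. e \<theta> \<le> s \<theta> y))}"
    and B: "B \<in> {Y. finite Y \<and> (Y = {} \<longrightarrow> (\<forall>y. e \<theta> \<le> s \<theta> y))}"
    and "A \<subseteq> B"
  have "set_scalarisation e s \<theta> A \<le> set_scalarisation e s \<theta> B"
    using mono_onD[OF mono_on_set_scalarisation[of e \<theta> s]] A B \<open>A \<subseteq> B\<close> by blast
  moreover have "set_scalarisation e s \<theta> (A \<union> {c}) = max (s \<theta> c) (set_scalarisation e s \<theta> A)"
    using A by (auto simp: set_scalarisation_insert)
  moreover have "set_scalarisation e s \<theta> (B \<union> {c}) = max (s \<theta> c) (set_scalarisation e s \<theta> B)"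
    using B by (auto simp: set_scalarisation_insert)
  ultimately show "set_scalarisation e s \<theta> (A \<union> {c}) - set_scalarisation e s \<theta> A
      \<ge> set_scalarisation e s \<theta> (B \<union> {c}) - set_scalarisation e s \<theta> B"
    by linarith
qed

lemma submodular_on_subset:
  assumes "submodular_on \<B> U" and "\<A> \<subseteq> \<B>"
  shows "submodular_on \<A> U"
  using assms unfolding submodular_on_def by blast

lemma mono_on_R2_utility:
  assumes wd: "R2_well_defined T p e s"
    and fin: "\<And>Y. Y \<in> \<B> \<Longrightarrow> finite Y"
    and mono: "\<And>\<theta>. \<theta> \<in> space T \<Longrightarrow> mono_on \<B> (set_scalarisation e s \<theta>)"
  shows "mono_on \<B> (R2_utility T p e s)"
proof (intro mono_onI)
  fix A B assume AB: "A \<in> \<B>" "B \<in> \<B>" "A \<subseteq> B"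
  show "R2_utility T p e s A \<le> R2_utility T p e s B"
    unfolding R2_utility_def
  proof (rule integral_mono)
    show "integrable (density T p) (\<lambda>\<theta>. set_scalarisation e s \<theta> A)"
      and "integrable (density T p) (\<lambda>\<theta>. set_scalarisation e s \<theta> B)"
      using wd fin AB by (auto simp: R2_well_defined_def)
    show "set_scalarisation e s \<theta> A \<le> set_scalarisation e s \<theta> B"
      if "\<theta> \<in> space (density T p)" for \<theta>
      using mono_onD[OF mono AB] that by simp
  qed
qed

lemma submodular_on_R2_utility:
  assumes wd: "R2_well_defined T p e s"
    and fin: "\<And>Y. Y \<in> \<B> \<Longrightarrow> finite Y"
    and sub: "\<And>\<theta>. \<theta> \<in> space T \<Longrightarrow> submodular_on \<B> (set_scalarisation e s \<theta>)"
  shows "submodular_on \<B> (R2_utility T p e s)"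
  unfolding submodular_on_def
proof (intro ballI allI impI)
  fix A B c assume AB: "A \<in> \<B>" "B \<in> \<B>" "A \<subseteq> B"
  let ?gain = "\<lambda>Y \<theta>. set_scalarisation e s \<theta> (Y \<union> {c}) - set_scalarisation e s \<theta> Y"
  have int: "integrable (density T p) (\<lambda>\<theta>. set_scalarisation e s \<theta> Y)" if "finite Y" for Y
    using wd that by (simp add: R2_well_defined_def)
  have gain: "R2_utility T p e s (Y \<union> {c}) - R2_utility T p e s Y
      = (\<integral>\<theta>. ?gain Y \<theta> \<partial>density T p)" if "finite Y" for Y
    unfolding R2_utility_def
    by (rule Bochner_Integration.integral_diff[symmetric]) (use that in \<open>auto intro!: int\<close>)
  have "(\<integral>\<theta>. ?gain B \<theta> \<partial>density T p) \<le> (\<integral>\<theta>. ?gain A \<theta> \<partial>density T p)"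
  proof (rule integral_mono)
    show "integrable (density T p) (?gain B)" and "integrable (density T p) (?gain A)"
      using fin AB by (auto intro!: Bochner_Integration.integrable_diff int)
    show "?gain B \<theta> \<le> ?gain A \<theta>" if "\<theta> \<in> space (density T p)" for \<theta>
      using sub[of \<theta>] that AB by (simp add: submodular_on_def)
  qed
  then show "R2_utility T p e s (A \<union> {c}) - R2_utility T p e s A
      \<ge> R2_utility T p e s (B \<union> {c}) - R2_utility T p e s B"
    using fin AB by (simp only: gain)
qed

lemma R2_utility_mono_on_and_submodular_on:
  assumes wd: "R2_well_defined T p e s"
    and \<B>: "\<B> \<subseteq> {Y. finite Y}"
    and empty: "\<And>\<theta> y. {} \<in> \<B> \<Longrightarrow> \<theta> \<in> space T \<Longrightarrow> e \<theta> \<le> s \<theta> y"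
  shows "mono_on \<B> (R2_utility T p e s)" and "submodular_on \<B> (R2_utility T p e s)"
proof -
  have sub: "\<B> \<subseteq> {Y. finite Y \<and> (Y = {} \<longrightarrow> (\<forall>y. e \<theta> \<le> s \<theta> y))}" if "\<theta> \<in> space T" for \<theta>
    using \<B> empty that by auto
  have fin: "finite Y" if "Y \<in> \<B>" for Y
    using \<B> that by blast
  show "mono_on \<B> (R2_utility T p e s)"
    using mono_on_R2_utility[OF wd fin] mono_on_subset[OF mono_on_set_scalarisation[of e _ s]] sub by metis
  show "submodular_on \<B> (R2_utility T p e s)"
    using submodular_on_R2_utility[OF wd fin]
      submodular_on_subset[OF submodular_on_set_scalarisation[of e _ s]] sub
    by metis
qed

theorem proposition3p1:
  fixes T :: "'t measure"
    and p :: "'t \<Rightarrow> real"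
    and s :: "'t \<Rightarrow> real ^ 'm \<Rightarrow> real"
    and e :: "'t \<Rightarrow> real"
  assumes "probability_density T p"
    and "R2_well_defined T p e s"
  shows "mono_on {Y. finite Y \<and> Y \<noteq> {}} (R2_utility T p e s) \<and>
         submodular_on {Y. finite Y \<and> Y \<noteq> {}} (R2_utility T p e s) \<and>
         ((\<forall>\<theta>\<in>space T. \<forall>y. e \<theta> \<le> s \<theta> y) \<longrightarrow>
            mono_on {Y. finite Y} (R2_utility T p e s) \<and>
            submodular_on {Y. finite Y} (R2_utility T p e s))"
proof (intro conjI impI)
  show "mono_on {Y. finite Y \<and> Y \<noteq> {}} (R2_utility T p e s)"
    and "submodular_on {Y. finite Y \<and> Y \<noteq> {}} (R2_utility T p e s)"
    by (rule R2_utility_mono_on_and_submodular_on[OF assms(2)]; auto)+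
next
  assume "\<forall>\<theta>\<in>space T. \<forall>y. e \<theta> \<le> s \<theta> y"
  then show "mono_on {Y. finite Y} (R2_utility T p e s)"
    and "submodular_on {Y. finite Y} (R2_utility T p e s)"
    by (auto intro!: R2_utility_mono_on_and_submodular_on[OF assms(2)])
qed

end
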